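(* Let $2\le k\le n-1$ and $\lambda\in\partial\Gamma_k(n)$. Put $\psi(y)=\frac12\sum_{i=1}^n\lambda_iy_i^2$ for $y\in\mathbb{R}^n$. (1) If $\lambda\in\mathbf{P}_2$, then $\psi$ is a solution of $S_k[\psi]=0$ and the linearized operator $\mathcal{L}_\psi=\sum_{i=1}^n\sigma_{k-1;i}(\lambda)\partial_i^2$ is uniformly elliptic. (2) If $\lambda\in\mathbf{P}_1$ with $\lambda_1\ge\dots\ge\lambda_n$, then $\psi$ is a convex (in the non-strict sense, i.e. $D^2\psi\ge0$) solution of $S_k[\psi]=0$, and $\mathcal{L}_\psi$ is degenerate elliptic with $\sigma_{k-1;i}(\lambda)=0$ for $1\le i\le k-1$. Moreover, if $\sigma_{k-1}(\lambda)=0$, then $\mathcal{L}_\psi=0$, that is, $\sigma_{k-1;i}(\lambda)=0$ for all $1\le i\le n$; and if $\sigma_{k-1}(\lambda)>0$, then $$\lambda_i>0\ (1\le i\le k-1),\qquad \lambda_i=0\ (k\le i\le n),$$ $$\sigma_{k-1;i}(\lambda)=0\ (1\le i\le k-1),\qquad \sigma_{k-1;i}(\lambda)=\prod_{j=1}^{k-1}\lambda_j>0\ (k\le i\le n).$$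
   Context: For $\lambda\in\mathbb{R}^n$, $\sigma_j(\lambda)$ is the $j$-th elementary symmetric polynomial, $\sigma_0=1$, and $\sigma_{j;i}(\lambda)=\partial\sigma_{j+1}(\lambda)/\partial\lambda_i$, i.e. $\sigma_j$ evaluated with $\lambda_i$ replaced by $0$. For $u\in C^2$, $S_k[u]=\sigma_k$ of the eigenvalues of $D^2u$. $\Gamma_k(n)=\{\lambda\in\mathbb{R}^n:\sigma_j(\lambda)>0,\ 1\le j\le k\}$ and $\partial\Gamma_k(n)=\{\lambda\in\mathbb{R}^n:\sigma_j(\lambda)\ge0\ (1\le j\le k-1),\ \sigma_k(\lambda)=0\}$. Set $\mathbf{P}_1=\{\lambda\in\partial\Gamma_k(n):\sigma_{k+1}(\lambda)=0\}$ and $\mathbf{P}_2=\{\lambda\in\partial\Gamma_k(n):\sigma_{k+1}(\lambda)<0\}$. The linearized operator of $S_k[\cdot]$ at $\psi=\frac12\sum\lambda_iy_i^2$ is $\mathcal{L}_\psi=\sum_{i=1}^n\sigma_{k-1;i}(\lambda)\partial_i^2$; it is uniformly elliptic if all coefficients $\sigma_{k-1;i}(\lambda)$ are positive, and degenerate elliptic if all are nonnegative and some vanish. *)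

theory Defs
  imports "HOL-Analysis.Analysis" "HOL-Computational_Algebra.Polynomial"
begin

definition esym :: "nat \<Rightarrow> real ^ 'n \<Rightarrow> real" where
  "esym j lam = (\<Sum>I | I \<subseteq> UNIV \<and> card I = j. \<Prod>i\<in>I. lam $ i)"

(* sigma_{j;i}: the entry i is replaced by 0 *)
definition esym_del :: "nat \<Rightarrow> 'n \<Rightarrow> real ^ 'n \<Rightarrow> real" where
  "esym_del j i lam = esym j (\<chi> m. if m = i then 0 else lam $ m)"

(* The paper's explicit set, not the topological frontier of a cone. *)
definition bd_Gamma :: "nat \<Rightarrow> (real ^ 'n) set" where
  "bd_Gamma k = {lam. (\<forall>j. 1 \<le> j \<and> j \<le> k - 1 \<longrightarrow> 0 \<le> esym j lam) \<and> esym k lam = 0}"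

definition P1 :: "nat \<Rightarrow> (real ^ 'n) set" where
  "P1 k = {lam \<in> bd_Gamma k. esym (k + 1) lam = 0}"

definition P2 :: "nat \<Rightarrow> (real ^ 'n) set" where
  "P2 k = {lam \<in> bd_Gamma k. esym (k + 1) lam < 0}"

definition pd :: "'n \<Rightarrow> (real ^ 'n \<Rightarrow> real) \<Rightarrow> real ^ 'n \<Rightarrow> real" where
  "pd i u y = frechet_derivative u (at y) (axis i 1)"

definition C2 :: "(real ^ 'n \<Rightarrow> real) \<Rightarrow> bool" where
  "C2 u \<longleftrightarrow> (\<forall>y. u differentiable at y) \<and> (\<forall>i y. pd i u differentiable at y)
     \<and> (\<forall>i j. continuous_on UNIV (pd i (pd j u)))"

definition hessian :: "(real ^ 'n \<Rightarrow> real) \<Rightarrow> real ^ 'n \<Rightarrow> real ^ 'n ^ 'n" where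
  "hessian u y = (\<chi> i j. pd i (pd j u) y)"

definition charpoly :: "real ^ 'n ^ 'n \<Rightarrow> real poly" where
  "charpoly A = det (mat [:0, 1:] - (\<chi> i j. [:A $ i $ j:]))"

(* The eigenvalues with multiplicity, in some order. They exist when all roots of the
   characteristic polynomial are real, in particular for symmetric matrices; the order
   is irrelevant below since only symmetric functions are applied to the tuple. *)
definition eigenvalues :: "real ^ 'n ^ 'n \<Rightarrow> real ^ 'n" where
  "eigenvalues A = (SOME \<mu>. charpoly A = (\<Prod>i\<in>UNIV. [:- \<mu> $ i, 1:]))"

definition S :: "nat \<Rightarrow> (real ^ 'n \<Rightarrow> real) \<Rightarrow> real ^ 'n \<Rightarrow> real" where
  "S k u y = esym k (eigenvalues (hessian u y))"

definition solves_S_eq_0 :: "nat \<Rightarrow> (real ^ 'n \<Rightarrow> real) \<Rightarrow> bool" where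
  "solves_S_eq_0 k u \<longleftrightarrow> C2 u \<and> (\<forall>y. S k u y = 0)"

definition pos_semidef :: "real ^ 'n ^ 'n \<Rightarrow> bool" where
  "pos_semidef A \<longleftrightarrow> transpose A = A \<and> (\<forall>v. 0 \<le> v \<bullet> (A *v v))"

definition psi :: "real ^ 'n \<Rightarrow> real ^ 'n \<Rightarrow> real" where
  "psi lam y = 1 / 2 * (\<Sum>i\<in>UNIV. lam $ i * (y $ i)\<^sup>2)"

definition diag_op :: "real ^ 'n \<Rightarrow> (real ^ 'n \<Rightarrow> real) \<Rightarrow> real ^ 'n \<Rightarrow> real" where
  "diag_op a v y = (\<Sum>i\<in>UNIV. a $ i * pd i (pd i v) y)"

definition linearized_op :: "nat \<Rightarrow> real ^ 'n \<Rightarrow> (real ^ 'n \<Rightarrow> real) \<Rightarrow> real ^ 'n \<Rightarrow> real" where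
  "linearized_op k lam = diag_op (\<chi> i. esym_del (k - 1) i lam)"

(* The operator determines its coefficients (diag_op_inject below), so the existential
   quantifiers refer to the coefficients of L. *)
definition uniformly_elliptic :: "((real ^ 'n \<Rightarrow> real) \<Rightarrow> real ^ 'n \<Rightarrow> real) \<Rightarrow> bool" where
  "uniformly_elliptic L \<longleftrightarrow> (\<exists>a. L = diag_op a \<and> (\<forall>i. 0 < a $ i))"

definition degenerate_elliptic :: "((real ^ 'n \<Rightarrow> real) \<Rightarrow> real ^ 'n \<Rightarrow> real) \<Rightarrow> bool" where
  "degenerate_elliptic L \<longleftrightarrow>
     (\<exists>a. L = diag_op a \<and> (\<forall>i. 0 \<le> a $ i) \<and> (\<exists>i. a $ i = 0))"

lemma pd_psi:
  fixes lam :: "real ^ 'n"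
  shows "pd i (psi lam) = (\<lambda>y. lam $ i * y $ i)"
proof
  fix y :: "real ^ 'n"
  have nth: "((\<lambda>x. x $ j) has_derivative (\<lambda>h. h $ j)) (at y)" for j
    by (rule bounded_linear_imp_has_derivative[OF bounded_linear_vec_nth])
  have "(psi lam has_derivative
          (\<lambda>h. 1 / 2 * (\<Sum>j\<in>UNIV. lam $ j * (of_nat 2 * h $ j * (y $ j) ^ (2 - 1))))) (at y)"
    unfolding psi_def[abs_def]
    by (intro has_derivative_mult_right has_derivative_sum has_derivative_power nth)
  then have "frechet_derivative (psi lam) (at y) =
      (\<lambda>h. 1 / 2 * (\<Sum>j\<in>UNIV. lam $ j * (of_nat 2 * h $ j * (y $ j) ^ (2 - 1))))"
    by (rule frechet_derivative_at[symmetric])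
  moreover have "lam $ j * (of_nat 2 * axis i 1 $ j * (y $ j) ^ (2 - 1)) =
      (if j = i then 2 * lam $ j * y $ j else 0)" for j
    by (simp add: axis_def)
  ultimately show "pd i (psi lam) y = lam $ i * y $ i"
    by (simp add: pd_def)
qed

lemma pd_pd_psi: "pd i (pd j (psi lam)) y = (if i = j then lam $ j else 0)"
proof -
  have "((\<lambda>y. lam $ j * y $ j) has_derivative (\<lambda>h. lam $ j * h $ j)) (at y)"
    by (intro has_derivative_mult_right bounded_linear_imp_has_derivative bounded_linear_vec_nth)
  then have "frechet_derivative (\<lambda>y. lam $ j * y $ j) (at y) = (\<lambda>h. lam $ j * h $ j)"
    by (rule frechet_derivative_at[symmetric])
  then show ?thesis
    by (auto simp: pd_psi pd_def axis_def)
qed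

lemma diag_op_inject: "diag_op a = diag_op b \<longleftrightarrow> a = b"
proof
  assume eq: "diag_op a = diag_op b"
  have *: "diag_op c (psi (axis i 1)) 0 = c $ i" for c :: "real ^ 'a" and i
  proof -
    have "c $ j * pd j (pd j (psi (axis i 1))) 0 = (if j = i then c $ j else 0)" for j
      by (simp add: pd_pd_psi axis_def)
    then show ?thesis
      by (simp add: diag_op_def)
  qed
  show "a = b"
    using *[of a] *[of b] eq by (simp add: vec_eq_iff)
qed simp

end

theory Submission
  imports Defs "HOL-Computational_Algebra.Fundamental_Theorem_Algebra"
begin

text \<open>The generating polynomial \<open>\<Prod>i. (1 + \<lambda>\<^sub>i t) = \<Sum>j. \<sigma>\<^sub>j t\<^sup>j\<close> has only real roots, and so do all its
  derivatives. If a polynomial \<open>b\<^sub>0 + b\<^sub>1 t + b\<^sub>2 t\<^sup>2 + \<dots>\<close> with \<open>b\<^sub>0 \<noteq> 0\<close> has only real roots \<open>r\<close>, then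
  \<open>b\<^sub>1\<^sup>2 - 2 b\<^sub>0 b\<^sub>2 = b\<^sub>0\<^sup>2 \<Sum>r. 1 / r\<^sup>2\<close>. Applied to the derivatives, this gives Newton's inequality and
  shows that two consecutive zeros \<open>\<sigma>\<^sub>j = \<sigma>\<^sub>j\<^sub>+\<^sub>1 = 0\<close> force all later \<open>\<sigma>\<^sub>m\<close> to vanish.

  On \<open>P\<^sub>1\<close> the generating polynomial therefore has degree below \<open>k\<close> and nonnegative coefficients, hence
  no positive root: fewer than \<open>k\<close> entries are nonzero, and none is negative. On \<open>P\<^sub>2\<close>, Newton's
  inequality gives \<open>\<sigma>\<^sub>k\<^sub>-\<^sub>1\<^sub>;\<^sub>i \<ge> 0\<close>; equality would force \<open>\<sigma>\<^sub>k\<^sub>;\<^sub>i = 0\<close>, so \<open>\<sigma>\<^sub>k\<^sub>+\<^sub>1\<^sub>;\<^sub>i = 0\<close> and \<open>\<sigma>\<^sub>k\<^sub>+\<^sub>1 = 0\<close>.\<close>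

subsection \<open>Real-rooted polynomials\<close>

text \<open>The zero polynomial is admitted, so that the class is closed under derivatives.\<close>

definition real_rooted :: "complex poly \<Rightarrow> bool" where
  "real_rooted p \<longleftrightarrow> p \<noteq> 0 \<longrightarrow> (\<forall>z. poly p z = 0 \<longrightarrow> z \<in> \<real>)"

lemma real_rooted_decompose:
  assumes "real_rooted p" "p \<noteq> 0"
  obtains r :: "nat \<Rightarrow> real"
  where "p = smult (lead_coeff p) (\<Prod>i<degree p. [:- of_real (r i), 1:])"
proof -
  obtain root where root: "smult (lead_coeff p) (\<Prod>i<degree p. [:- root i, 1:]) = p"
    by (rule complex_poly_decompose')
  have "root i \<in> \<real>" if "i < degree p" for i
  proof -
    have "poly (smult (lead_coeff p) (\<Prod>i<degree p. [:- root i, 1:])) (root i) = 0"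
      using that by (auto simp: poly_prod)
    then have "poly p (root i) = 0"
      unfolding root .
    then show ?thesis
      using assms by (auto simp: real_rooted_def)
  qed
  then have "(\<Prod>i<degree p. [:- root i, 1:]) = (\<Prod>i<degree p. [:- of_real (Re (root i)), 1:])"
    by (intro prod.cong) auto
  then show thesis
    using root that[of "\<lambda>i. Re (root i)"] by simp
qed

text \<open>Logarithmic derivative: p' / p is the sum of the 1 / (z - r_i).\<close>

lemma poly_pderiv_prod_linear:
  fixes r :: "nat \<Rightarrow> 'a :: field_char_0"
  assumes "\<And>i. i < n \<Longrightarrow> z \<noteq> r i"
  shows "poly (pderiv (\<Prod>i<n. [:- r i, 1:])) z
       = poly (\<Prod>i<n. [:- r i, 1:]) z * (\<Sum>i<n. 1 / (z - r i))"
  using assms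
proof (induction n)
  case (Suc n)
  define q where "q = (\<Prod>i<n. [:- r i, 1:])"
  have "poly (pderiv q) z = poly q z * (\<Sum>i<n. 1 / (z - r i))"
    unfolding q_def using Suc by simp
  moreover have "(\<Prod>i<Suc n. [:- r i, 1:]) = q * [:- r n, 1:]"
    by (simp add: q_def del: mult_pCons_right)
  moreover have "z - r n \<noteq> 0"
    using Suc.prems by simp
  ultimately show ?case
    by (simp add: pderiv_mult pderiv_pCons field_simps del: mult_pCons_right)
qed simp

text \<open>Inversion swaps the two half-planes, so all terms of the logarithmic derivative lie
  strictly on one side of the real axis and cannot cancel.\<close>

lemma Im_inverse_sub_real:
  assumes "Im z \<noteq> 0"
  shows "Im (1 / (z - of_real r)) * Im z < 0"
proof -
  have "(Re z - r)\<^sup>2 + (Im z)\<^sup>2 > 0"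
    using assms by (simp add: add_nonneg_pos)
  moreover have "Im z * Im z > 0"
    using assms by (metis not_real_square_gt_zero)
  ultimately show ?thesis
    by (simp add: Im_divide divide_neg_pos)
qed

text \<open>Gauss-Lucas for the real line: off the axis neither p nor its logarithmic derivative
  vanishes.\<close>

lemma real_rooted_pderiv:
  assumes "real_rooted p"
  shows "real_rooted (pderiv p)"
  unfolding real_rooted_def
proof (intro impI allI)
  fix z assume nz: "pderiv p \<noteq> 0" and root: "poly (pderiv p) z = 0"
  \<comment> \<open>A nonzero derivative forces positive degree, so the sum \<open>s\<close> below
    has at least one term.\<close>
  then have "p \<noteq> 0" and deg: "degree p > 0"
    by (auto simp: pderiv_eq_0_iff)
  then obtain r :: "nat \<Rightarrow> real"
    where p: "p = smult (lead_coeff p) (\<Prod>i<degree p. [:- of_real (r i), 1:])"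
    using real_rooted_decompose[OF assms] by blast
  show "z \<in> \<real>"
  proof (rule ccontr)
    assume z: "z \<notin> \<real>"
    then have im: "Im z \<noteq> 0" and ne: "z \<noteq> of_real x" for x
      by (auto simp: complex_is_Real_iff)
    define s where "s = (\<Sum>i<degree p. 1 / (z - of_real (r i)))"
    have "Im s * Im z = (\<Sum>i<degree p. Im (1 / (z - of_real (r i))) * Im z)"
      by (simp add: s_def sum_distrib_right)
    also have "\<dots> < (\<Sum>i<degree p. 0)"
      using deg Im_inverse_sub_real[OF im] by (intro sum_strict_mono) auto
    finally have "s \<noteq> 0"
      by auto
    moreover have "poly (pderiv p) z = poly p z * s"
    proof -
      have "pderiv p = smult (lead_coeff p) (pderiv (\<Prod>i<degree p. [:- of_real (r i), 1:]))"
        by (subst p) (rule pderiv_smult)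
      moreover have "poly p z = lead_coeff p * poly (\<Prod>i<degree p. [:- of_real (r i), 1:]) z"
        by (subst p) (rule poly_smult)
      ultimately show ?thesis
        using poly_pderiv_prod_linear[of "degree p" z "\<lambda>i. of_real (r i)"] ne
        by (simp add: s_def)
    qed
    moreover have "poly p z \<noteq> 0"
      using assms z \<open>p \<noteq> 0\<close> by (auto simp: real_rooted_def)
    ultimately show False
      using root by simp
  qed
qed

lemma real_rooted_higher_pderiv: "real_rooted p \<Longrightarrow> real_rooted ((pderiv ^^ m) p)"
  by (induction m) (auto intro: real_rooted_pderiv)

text \<open>With x_i = 1 / r_i, Vieta gives b_1 / b_0 = - e_1(x) and b_2 / b_0 = e_2(x), and e_1^2 -
  2 e_2 is the sum of squares.\<close>

lemma coeff_prod_linear_square: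
  fixes r :: "nat \<Rightarrow> 'a :: field"
  assumes "coeff (\<Prod>i<n. [:- r i, 1:]) 0 \<noteq> 0"
  shows "(coeff (\<Prod>i<n. [:- r i, 1:]) 1)\<^sup>2
         - 2 * coeff (\<Prod>i<n. [:- r i, 1:]) 0 * coeff (\<Prod>i<n. [:- r i, 1:]) 2
       = (coeff (\<Prod>i<n. [:- r i, 1:]) 0)\<^sup>2 * (\<Sum>i<n. 1 / (r i)\<^sup>2)"
  using assms
proof (induction n)
  case (Suc n)
  define q where "q = (\<Prod>i<n. [:- r i, 1:])"
  have Q: "(\<Prod>i<Suc n. [:- r i, 1:]) = [:- r n, 1:] * q"
    by (simp add: q_def mult.commute)
  have c: "coeff ([:- r n, 1:] * q) 0 = - r n * coeff q 0"
    "coeff ([:- r n, 1:] * q) 1 = - r n * coeff q 1 + coeff q 0"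
    "coeff ([:- r n, 1:] * q) 2 = - r n * coeff q 2 + coeff q 1"
    by (simp_all add: coeff_pCons numeral_2_eq_2)
  have nz: "r n \<noteq> 0" "coeff q 0 \<noteq> 0"
    using Suc.prems unfolding Q c by auto
  then have IH: "(coeff q 1)\<^sup>2 - 2 * coeff q 0 * coeff q 2 = (coeff q 0)\<^sup>2 * (\<Sum>i<n. 1 / (r i)\<^sup>2)"
    using Suc.IH by (simp add: q_def)
  \<comment> \<open>The mixed terms cancel; the last summand (q_0)^2 is the contribution of the new
    1 / (r_n)^2.\<close>
  have "(- r n * coeff q 1 + coeff q 0)\<^sup>2
         - 2 * (- r n * coeff q 0) * (- r n * coeff q 2 + coeff q 1)
       = (r n)\<^sup>2 * ((coeff q 1)\<^sup>2 - 2 * coeff q 0 * coeff q 2) + (coeff q 0)\<^sup>2"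
    by (simp add: power2_eq_square algebra_simps)
  also have "\<dots> = (- r n * coeff q 0)\<^sup>2 * (\<Sum>i<Suc n. 1 / (r i)\<^sup>2)"
    unfolding IH using nz by (simp add: power2_eq_square field_simps)
  finally show ?case
    unfolding Q c .
qed simp

text \<open>For real roots the sum of the 1 / r^2 is nonnegative, and it is zero only if there is no
  root at all.\<close>

lemma real_rooted_coeffs:
  assumes rr: "real_rooted p" and nz: "coeff p 0 \<noteq> 0"
    and b: "coeff p 0 = of_real b0" "coeff p 1 = of_real b1" "coeff p 2 = of_real b2"
  shows "2 * b0 * b2 \<le> b1\<^sup>2"
    and "b1 = 0 \<Longrightarrow> b2 = 0 \<Longrightarrow> degree p = 0"
proof -
  have "p \<noteq> 0"
    using nz by auto
  then obtain r :: "nat \<Rightarrow> real"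
    where p: "p = smult (lead_coeff p) (\<Prod>i<degree p. [:- of_real (r i), 1:])"
    using real_rooted_decompose[OF rr] by blast
  define c where "c = lead_coeff p"
  define n where "n = degree p"
  define q :: "complex poly" where "q = (\<Prod>i<n. [:- of_real (r i), 1:])"
  have pq: "p = smult c q"
    using p by (simp add: c_def n_def q_def)
  have q0: "coeff q 0 \<noteq> 0"
    using nz by (auto simp: pq)
  have "(coeff q 1)\<^sup>2 - 2 * coeff q 0 * coeff q 2 = (coeff q 0)\<^sup>2 * (\<Sum>i<n. 1 / (of_real (r i))\<^sup>2)"
    using coeff_prod_linear_square[where n = n and r = "\<lambda>i. of_real (r i)"] q0 by (simp add: q_def)
  moreover have "(coeff p 1)\<^sup>2 - 2 * coeff p 0 * coeff p 2
      = c\<^sup>2 * ((coeff q 1)\<^sup>2 - 2 * coeff q 0 * coeff q 2)"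
    by (simp add: pq power2_eq_square algebra_simps)
  ultimately have "(coeff p 1)\<^sup>2 - 2 * coeff p 0 * coeff p 2
      = (coeff p 0)\<^sup>2 * (\<Sum>i<n. 1 / (of_real (r i))\<^sup>2)"
    by (simp add: pq power_mult_distrib)
  then have "complex_of_real (b1\<^sup>2 - 2 * b0 * b2) = of_real (b0\<^sup>2 * (\<Sum>i<n. 1 / (r i)\<^sup>2))"
    unfolding b by simp
  then have eq: "b1\<^sup>2 - 2 * b0 * b2 = b0\<^sup>2 * (\<Sum>i<n. 1 / (r i)\<^sup>2)"
    unfolding of_real_eq_iff .
  have "b0\<^sup>2 * (\<Sum>i<n. 1 / (r i)\<^sup>2) \<ge> 0"
    by (intro mult_nonneg_nonneg sum_nonneg) auto
  with eq show "2 * b0 * b2 \<le> b1\<^sup>2"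
    by simp
  show "degree p = 0" if "b1 = 0" "b2 = 0"
  proof (rule ccontr)
    assume "degree p \<noteq> 0"
    then have "0 < n"
      by (simp add: n_def)
    \<comment> \<open>A zero root would make the constant coefficient vanish.\<close>
    have "r i \<noteq> 0" if "i < n" for i
      using q0 that by (auto simp: q_def poly_prod simp flip: poly_0_coeff_0)
    then have "(\<Sum>i<n. 1 / (r i)\<^sup>2) > 0"
      using \<open>0 < n\<close> by (intro sum_pos) auto
    moreover have "b0 \<noteq> 0"
      using nz b by auto
    ultimately show False
      using eq that by simp
  qed
qed

subsection \<open>Elementary symmetric functions\<close>

text \<open>Expanding the product picks 1 or the linear term from each factor; degree j collects the
  subsets of size j.\<close>

lemma coeff_prod_one_plus:
  fixes f :: "'i \<Rightarrow> 'a :: comm_semiring_1"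
  assumes "finite A"
  shows "coeff (\<Prod>i\<in>A. [:1, f i:]) j = (\<Sum>I | I \<subseteq> A \<and> card I = j. \<Prod>i\<in>I. f i)"
proof -
  have "(\<Prod>i\<in>A. [:1, f i:]) = (\<Prod>i\<in>A. monom (f i) 1 + 1)"
    by (intro prod.cong refl) (simp add: monom_altdef one_pCons)
  also have "\<dots> = (\<Sum>I\<in>Pow A. \<Prod>i\<in>I. monom (f i) 1)"
    using prod_add[OF assms, of "\<lambda>i. monom (f i) 1" "\<lambda>_. 1"] by simp
  also have "\<dots> = (\<Sum>I\<in>Pow A. monom (\<Prod>i\<in>I. f i) (card I))"
  proof (intro sum.cong refl)
    fix I assume "I \<in> Pow A"
    then have "finite I"
      using assms finite_subset by auto
    then show "(\<Prod>i\<in>I. monom (f i) 1) = monom (\<Prod>i\<in>I. f i) (card I)"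
      by induction (simp_all add: mult_monom)
  qed
  finally have "coeff (\<Prod>i\<in>A. [:1, f i:]) j
      = (\<Sum>I\<in>Pow A. if card I = j then \<Prod>i\<in>I. f i else 0)"
    by (simp add: coeff_sum)
  also have "\<dots> = (\<Sum>I | I \<subseteq> A \<and> card I = j. \<Prod>i\<in>I. f i)"
    using assms by (simp add: sum.If_cases Pow_def Collect_conj_eq)
  finally show ?thesis .
qed

lemma esym_eq_coeff: "esym j lam = coeff (\<Prod>i\<in>UNIV. [:1, lam $ i:]) j"
  by (simp add: esym_def coeff_prod_one_plus)

lemma of_real_esym_eq_coeff:
  "complex_of_real (esym j lam) = coeff (\<Prod>i\<in>UNIV. [:1, complex_of_real (lam $ i):]) j"
  by (simp add: esym_def coeff_prod_one_plus)

lemma esym_0 [simp]: "esym 0 lam = 1"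
  by (simp add: esym_eq_coeff poly_prod flip: poly_0_coeff_0)

text \<open>Zeroing entry i turns the factor 1 + \<lambda>_i t of the generating polynomial into 1;
  coefficients are compared after taking out this factor.\<close>

lemma esym_Suc_del:
  "esym (Suc j) lam = esym_del (Suc j) i lam + lam $ i * esym_del j i lam"
proof -
  define lam' where "lam' = (\<chi> m. if m = i then 0 else lam $ m)"
  have "(\<Prod>m\<in>UNIV. [:1, lam $ m:]) = [:1, lam $ i:] * (\<Prod>m\<in>UNIV - {i}. [:1, lam $ m:])"
    by (simp add: prod.remove)
  also have "(\<Prod>m\<in>UNIV - {i}. [:1, lam $ m:]) = (\<Prod>m\<in>UNIV - {i}. [:1, lam' $ m:])"
    by (intro prod.cong) (auto simp: lam'_def)
  also have "\<dots> = [:1, lam' $ i:] * (\<Prod>m\<in>UNIV - {i}. [:1, lam' $ m:])"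
    by (simp add: lam'_def)
  also have "\<dots> = (\<Prod>m\<in>UNIV. [:1, lam' $ m:])"
    by (simp add: prod.remove)
  finally show ?thesis
    by (simp add: esym_eq_coeff esym_del_def lam'_def)
qed

lemma esym_nonneg: "(\<And>i. 0 \<le> lam $ i) \<Longrightarrow> 0 \<le> esym j lam"
  unfolding esym_def by (intro sum_nonneg prod_nonneg) auto

lemma esym_uminus: "esym j (- lam) = (- 1) ^ j * esym j lam"
proof -
  have "esym j (- lam) = (\<Sum>I | I \<subseteq> UNIV \<and> card I = j. (- 1) ^ j * (\<Prod>i\<in>I. lam $ i))"
    unfolding esym_def by (intro sum.cong refl) (auto simp: prod_uminus)
  then show ?thesis
    by (simp add: esym_def sum_distrib_left)
qed

lemma esym_eq_0_if_card_support_less: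
  fixes lam :: "real ^ 'n"
  assumes "card {i. lam $ i \<noteq> 0} < j"
  shows "esym j lam = 0"
  unfolding esym_def
proof (intro sum.neutral ballI)
  fix I :: "'n set" assume "I \<in> {I. I \<subseteq> UNIV \<and> card I = j}"
  then have "\<not> I \<subseteq> {i. lam $ i \<noteq> 0}"
    using assms card_mono[of "{i. lam $ i \<noteq> 0}" I] by auto
  then show "(\<Prod>i\<in>I. lam $ i) = 0"
    by auto
qed

text \<open>Any other set of the same size leaves \<open>N\<close> and picks up a zero
  entry.\<close>

lemma esym_card_support:
  assumes "{i. lam $ i \<noteq> 0} \<subseteq> N"
  shows "esym (card N) lam = (\<Prod>i\<in>N. lam $ i)"
proof -
  have "esym (card N) lam = (\<Sum>I\<in>{N}. \<Prod>i\<in>I. lam $ i)"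
    unfolding esym_def
  proof (intro sum.mono_neutral_right ballI)
    fix I assume I: "I \<in> {I. I \<subseteq> UNIV \<and> card I = card N} - {N}"
    then have "\<not> I \<subseteq> N"
      using card_subset_eq[of N I] by auto
    then show "(\<Prod>i\<in>I. lam $ i) = 0"
      using assms by auto
  qed auto
  then show ?thesis
    by simp
qed

section \<open>Newton's inequality and consecutive zeros\<close>

lemma real_rooted_esym_poly: "real_rooted (\<Prod>i\<in>UNIV. [:1, complex_of_real (lam $ i):])"
  unfolding real_rooted_def
proof (intro impI allI)
  fix z assume "poly (\<Prod>i\<in>UNIV. [:1, complex_of_real (lam $ i):]) z = 0"
  then obtain i where "1 + z * of_real (lam $ i) = 0"
    by (auto simp: poly_prod)
  then have "z = of_real (- 1 / lam $ i)"
    by (cases "lam $ i = 0") (auto simp: field_simps add_eq_0_iff)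
  then show "z \<in> \<real>"
    by (metis Reals_of_real)
qed

lemma fact_mult_pochhammer_Suc:
  "fact n * pochhammer (of_nat (Suc n)) m = (fact (n + m) :: 'a :: field_char_0)"
proof (induction m)
  case (Suc m)
  have "fact n * pochhammer (of_nat (Suc n)) (Suc m)
      = (fact n * pochhammer (of_nat (Suc n)) m) * (of_nat (Suc n + m) :: 'a)"
    by (simp add: pochhammer_Suc mult.assoc)
  also have "\<dots> = fact (n + Suc m)"
    unfolding Suc.IH by (simp add: mult.commute)
  finally show ?case .
qed simp

lemma coeff_higher_pderiv_esym_poly:
  "coeff ((pderiv ^^ m) (\<Prod>i\<in>UNIV. [:1, complex_of_real (lam $ i):])) n
     = of_real (fact (n + m) / fact n * esym (n + m) lam)"
  using fact_mult_pochhammer_Suc[of n m, where 'a = complex]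
  by (simp add: coeff_higher_pderiv of_real_esym_eq_coeff field_simps)

text \<open>The constant is free of the dimension; what matters later is (j + 1) / (j + 2) <
  1.\<close>

lemma esym_Newton:
  "(real j + 2) * (esym j lam * esym (j + 2) lam) \<le> (real j + 1) * (esym (j + 1) lam)\<^sup>2"
proof (cases "esym j lam = 0")
  case False
  define p where "p = (pderiv ^^ j) (\<Prod>i\<in>UNIV. [:1, complex_of_real (lam $ i):])"
  define f :: real where "f = fact j"
  have f: "f > 0"
    by (simp add: f_def)
  \<comment> \<open>The first three coefficients of \<open>p\<close> are j! sigma_j, (j+1)!
    sigma_(j+1) and (j+2)!/2 sigma_(j+2), written with f = j!.\<close>
  have "2 * (f * esym j lam) * ((real j + 2) * (real j + 1) * f / 2 * esym (j + 2) lam)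
      \<le> ((real j + 1) * f * esym (j + 1) lam)\<^sup>2"
  proof (rule real_rooted_coeffs(1)[of p])
    show "real_rooted p"
      unfolding p_def by (intro real_rooted_higher_pderiv real_rooted_esym_poly)
  qed (use False in \<open>simp_all add: p_def f_def coeff_higher_pderiv_esym_poly algebra_simps
        numeral_2_eq_2\<close>)
  then have "((real j + 1) * f\<^sup>2) * ((real j + 2) * (esym j lam * esym (j + 2) lam))
      \<le> ((real j + 1) * f\<^sup>2) * ((real j + 1) * (esym (j + 1) lam)\<^sup>2)"
    by (simp add: power2_eq_square algebra_simps)
  then show ?thesis
    by (rule mult_left_le_imp_le) (use f in simp)
qed simp

text \<open>The pair of zeros is moved down until it directly follows a nonzero sigma_l (sigma_0 = 1
  at the latest). Then the l-th derivative has b_0 nonzero and b_1 = b_2 = 0, so it is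
  constant.\<close>

lemma esym_eq_0_if_consecutive:
  assumes "esym j lam = 0" "esym (Suc j) lam = 0" "j \<le> m"
  shows "esym m lam = 0"
proof -
  define l where "l = (GREATEST l. l \<le> j \<and> esym l lam \<noteq> 0)"
  have l: "l \<le> j \<and> esym l lam \<noteq> 0"
    unfolding l_def by (rule GreatestI_nat[where k = 0 and b = j]) auto
  have greatest: "i \<le> l" if "i \<le> j" "esym i lam \<noteq> 0" for i
    unfolding l_def by (rule Greatest_le_nat[where b = j]) (use that in auto)
  have "l < j"
    using l assms(1) by (cases "l = j") auto
  have "esym (Suc l) lam = 0"
    using greatest[of "Suc l"] \<open>l < j\<close> by auto
  \<comment> \<open>If l + 1 = j, this is the second given zero; otherwise l + 2 \<le> j and
    maximality of \<open>l\<close> applies.\<close>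
  moreover have "esym (Suc (Suc l)) lam = 0"
    using greatest[of "Suc (Suc l)"] \<open>l < j\<close> assms(2) by (cases "Suc l = j") auto
  moreover define p where "p = (pderiv ^^ l) (\<Prod>i\<in>UNIV. [:1, complex_of_real (lam $ i):])"
  ultimately have "degree p = 0"
    using l
    by (intro real_rooted_coeffs(2)[of p "fact l * esym l lam" 0 0])
       (auto simp: p_def coeff_higher_pderiv_esym_poly numeral_2_eq_2
          intro!: real_rooted_higher_pderiv real_rooted_esym_poly)
  then have "coeff p (m - l) = 0"
    using \<open>l < j\<close> assms(3) by (intro coeff_eq_0) auto
  then have "fact (m - l + l) / fact (m - l) * esym (m - l + l) lam = 0"
    unfolding p_def coeff_higher_pderiv_esym_poly of_real_eq_0_iff .
  then show ?thesis
    using \<open>l < j\<close> assms(3) by simp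
qed

section \<open>Signs on \<open>P1\<close> and \<open>P2\<close>\<close>

lemma esym_del_nonneg:
  assumes "\<And>m. m \<le> Suc j \<Longrightarrow> 0 \<le> esym m lam"
  shows "0 \<le> esym_del j i lam"
  using assms
proof (induction j)
  case (Suc j)
  define q where "q = (\<lambda>j. esym_del j i lam)"
  define x where "x = lam $ i"
  have q0: "0 \<le> q j"
    using Suc by (simp add: q_def)
  have rec1: "0 \<le> q (Suc j) + x * q j"
    using Suc.prems[of "Suc j"] esym_Suc_del[of j lam i] by (simp add: q_def x_def)
  have rec2: "0 \<le> q (Suc (Suc j)) + x * q (Suc j)"
    using Suc.prems[of "Suc (Suc j)"] esym_Suc_del[of "Suc j" lam i] by (simp add: q_def x_def)
  have newton: "(real j + 2) * (q j * q (Suc (Suc j))) \<le> (real j + 1) * (q (Suc j))\<^sup>2"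
    using esym_Newton[of j] by (simp add: q_def esym_del_def)
  have "0 \<le> q (Suc j)"
  proof (rule ccontr)
    assume "\<not> 0 \<le> q (Suc j)"
    then have neg: "q (Suc j) < 0"
      by simp
    \<comment> \<open>The recursions bound - q_(j+1) by x q_j and - x q_(j+1) by q_(j+2).
      Multiplying by - q_(j+1) > 0 and by q_j \<ge> 0 eliminates \<open>x\<close>, whose sign is
      unknown; the result contradicts Newton's inequality.\<close>
    have "(- q (Suc j)) * (- q (Suc j)) \<le> (x * q j) * (- q (Suc j))"
      using rec1 neg by (intro mult_right_mono) auto
    also have "\<dots> = q j * (- (x * q (Suc j)))"
      by simp
    also have "\<dots> \<le> q j * q (Suc (Suc j))"
      using rec2 q0 by (intro mult_left_mono) auto
    finally have "(q (Suc j))\<^sup>2 \<le> q j * q (Suc (Suc j))"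
      by (simp add: power2_eq_square)
    then have "(real j + 2) * (q (Suc j))\<^sup>2 \<le> (real j + 2) * (q j * q (Suc (Suc j)))"
      by (intro mult_left_mono) auto
    with newton have "(real j + 2) * (q (Suc j))\<^sup>2 \<le> (real j + 1) * (q (Suc j))\<^sup>2"
      by linarith
    then have "real j + 2 \<le> real j + 1"
      by (rule mult_right_le_imp_le) (use neg in simp)
    then show False
      by simp
  qed
  then show ?case
    by (simp add: q_def)
qed (simp add: esym_del_def)

lemma esym_del_pos:
  assumes "lam \<in> P2 k" "2 \<le> k"
  shows "0 < esym_del (k - 1) i lam"
proof -
  obtain j where k: "k = Suc (Suc j)"
    using assms(2) by (metis One_nat_def Suc_1 Suc_le_D Suc_le_mono)
  have bd: "\<And>m. 1 \<le> m \<Longrightarrow> m \<le> Suc j \<Longrightarrow> 0 \<le> esym m lam" "esym (Suc (Suc j)) lam = 0"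
    and neg: "esym (Suc (Suc (Suc j))) lam < 0"
    using assms by (auto simp: P2_def bd_Gamma_def k)
  \<comment> \<open>sigma_0 = 1 and sigma_k = 0 extend the bounds to all indices up to k, one beyond
    the index k - 1 of the conclusion.\<close>
  have "0 \<le> esym m lam" if "m \<le> Suc (Suc j)" for m
    using that bd by (cases "m = 0"; cases "m = Suc (Suc j)") auto
  then have "0 \<le> esym_del (Suc j) i lam"
    by (rule esym_del_nonneg)
  moreover have "esym_del (Suc j) i lam \<noteq> 0"
  proof
    assume 0: "esym_del (Suc j) i lam = 0"
    then have 1: "esym_del (Suc (Suc j)) i lam = 0"
      using bd(2) esym_Suc_del[of "Suc j" lam i] by simp
    \<comment> \<open>The two consecutive zeros belong to the vector with entry i set to 0.\<close>
    have "esym_del (Suc (Suc (Suc j))) i lam = 0"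
      using 0 1 unfolding esym_del_def by (rule esym_eq_0_if_consecutive) simp
    with 1 neg show False
      using esym_Suc_del[of "Suc (Suc j)" lam i] by simp
  qed
  ultimately show ?thesis
    by (simp add: k)
qed

lemma nonneg_if_esym_nonneg:
  assumes "\<And>j. 0 \<le> esym j lam"
  shows "0 \<le> lam $ i"
proof (rule ccontr)
  assume "\<not> 0 \<le> lam $ i"
  then have neg: "lam $ i < 0"
    by simp
  define p where "p = (\<Prod>i\<in>UNIV. [:1, lam $ i:])"
  \<comment> \<open>The root contributed by a negative entry; on t \<ge> 0 the polynomial is at
    least its constant coefficient 1.\<close>
  define t where "t = - 1 / lam $ i"
  have "1 + t * lam $ i = 0" "0 \<le> t"
    using neg by (simp_all add: t_def field_simps)
  have "coeff p j = esym j lam" for j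
    by (simp add: p_def esym_eq_coeff)
  moreover from this have "coeff p 0 * t ^ 0 \<le> (\<Sum>j\<le>degree p. coeff p j * t ^ j)"
    using assms \<open>0 \<le> t\<close> by (intro member_le_sum) auto
  ultimately have "1 \<le> poly p t"
    by (simp add: poly_altdef)
  moreover have "poly p t = 0"
    using \<open>1 + t * lam $ i = 0\<close> by (auto simp: p_def poly_prod)
  ultimately show False
    by simp
qed

lemma P1_nonneg_card_support:
  assumes "lam \<in> P1 k"
  shows "0 \<le> lam $ i" and "card {i. lam $ i \<noteq> 0} < k"
proof -
  have bd: "\<And>m. 1 \<le> m \<Longrightarrow> m \<le> k - 1 \<Longrightarrow> 0 \<le> esym m lam" "esym k lam = 0" "esym (Suc k) lam = 0"
    using assms by (auto simp: P1_def bd_Gamma_def)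
  have high: "esym m lam = 0" if "k \<le> m" for m
    using esym_eq_0_if_consecutive bd that by blast
  have "0 \<le> esym m lam" for m
    using bd(1)[of m] high[of m] by (cases "m = 0"; cases "k \<le> m") auto
  then show "0 \<le> lam $ i"
    by (rule nonneg_if_esym_nonneg)
  \<comment> \<open>At the size of the support, sigma is the product of the nonzero entries.\<close>
  have "esym (card {i. lam $ i \<noteq> 0}) lam \<noteq> 0"
    by (simp add: esym_card_support)
  then show "card {i. lam $ i \<noteq> 0} < k"
    using high not_less by blast
qed

subsection \<open>The quadratic solution\<close>

lemma hessian_psi: "hessian (psi lam) y = (\<chi> i j. if i = j then lam $ j else 0)"
  by (simp add: hessian_def pd_pd_psi)

text \<open>\<open>eigenvalues\<close> chooses some tuple with the right characteristic polynomial.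
  Reversing the coefficients of that polynomial gives the generating polynomial of -\<lambda>, which
  fixes every sigma_k.\<close>

lemma esym_eigenvalues_diagonal:
  "esym k (eigenvalues (\<chi> i j. if i = j then lam $ j else 0)) = esym k lam"
proof -
  define A where "A = (\<chi> i j. if i = j then lam $ j else 0)"
  define \<mu> where "\<mu> = eigenvalues A"
  have char: "charpoly A = (\<Prod>i\<in>UNIV. [:- lam $ i, 1:])"
    unfolding charpoly_def by (subst det_diagonal) (auto simp: A_def mat_def)
  \<comment> \<open>\<open>lam\<close> itself witnesses that a tuple to choose exists.\<close>
  then have "charpoly A = (\<Prod>i\<in>UNIV. [:- \<mu> $ i, 1:])"
    unfolding \<mu>_def eigenvalues_def by (rule someI)
  with char have "reflect_poly (\<Prod>i\<in>UNIV. [:- \<mu> $ i, 1:]) = reflect_poly (\<Prod>i\<in>UNIV. [:- lam $ i, 1:])"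
    by simp
  moreover have "reflect_poly [:- x, 1:] = [:1, - x:]" for x :: real
    by (cases "x = 0") (simp_all add: reflect_poly_def cCons_def)
  ultimately have "(\<Prod>i\<in>UNIV. [:1, (- \<mu>) $ i:]) = (\<Prod>i\<in>UNIV. [:1, (- lam) $ i:])"
    by (simp add: reflect_poly_prod)
  then have "esym k (- \<mu>) = esym k (- lam)"
    unfolding esym_eq_coeff by (rule arg_cong)
  then show ?thesis
    by (simp add: esym_uminus \<mu>_def A_def)
qed

lemma solves_S_eq_0_psi:
  assumes "esym k lam = 0"
  shows "solves_S_eq_0 k (psi lam)"
proof -
  have "psi lam differentiable at y" for y
    unfolding psi_def[abs_def]
    by (intro differentiable_mult differentiable_sum differentiable_power differentiable_const
        bounded_linear_imp_differentiable bounded_linear_vec_nth finite ballI)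
  moreover have "pd i (psi lam) differentiable at y" for i y
    unfolding pd_psi
    by (intro differentiable_mult differentiable_const
        bounded_linear_imp_differentiable bounded_linear_vec_nth)
  moreover have "continuous_on UNIV (pd i (pd j (psi lam)))" for i j
  proof -
    have "pd i (pd j (psi lam)) = (\<lambda>y. if i = j then lam $ j else 0)"
      by (simp add: fun_eq_iff pd_pd_psi)
    then show ?thesis
      by simp
  qed
  ultimately show ?thesis
    using assms by (simp add: solves_S_eq_0_def C2_def S_def hessian_psi esym_eigenvalues_diagonal)
qed

lemma convex_on_psi:
  assumes "\<And>i. 0 \<le> lam $ i"
  shows "convex_on UNIV (psi lam)"
proof (rule convex_onI)
  fix t :: real and x y :: "real ^ 'a"
  assume t: "0 < t" "t < 1"
  have sq: "((1 - t) * a + t * b)\<^sup>2 \<le> (1 - t) * a\<^sup>2 + t * b\<^sup>2" for a b :: real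
  proof -
    have "(1 - t) * a\<^sup>2 + t * b\<^sup>2 - ((1 - t) * a + t * b)\<^sup>2 = t * (1 - t) * (a - b)\<^sup>2"
      by (simp add: power2_eq_square algebra_simps)
    moreover have "\<dots> \<ge> 0"
      using t by simp
    ultimately show ?thesis
      by linarith
  qed
  have "(\<Sum>i\<in>UNIV. lam $ i * (((1 - t) *\<^sub>R x + t *\<^sub>R y) $ i)\<^sup>2)
      \<le> (\<Sum>i\<in>UNIV. lam $ i * ((1 - t) * (x $ i)\<^sup>2 + t * (y $ i)\<^sup>2))"
    using assms sq by (intro sum_mono mult_left_mono) simp_all
  also have "\<dots> = (1 - t) * (\<Sum>i\<in>UNIV. lam $ i * (x $ i)\<^sup>2) + t * (\<Sum>i\<in>UNIV. lam $ i * (y $ i)\<^sup>2)"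
    by (simp add: sum_distrib_left sum.distrib[symmetric] algebra_simps)
  finally show "psi lam ((1 - t) *\<^sub>R x + t *\<^sub>R y) \<le> (1 - t) * psi lam x + t * psi lam y"
    by (simp add: psi_def)
qed simp

lemma pos_semidef_hessian_psi:
  assumes "\<And>i. 0 \<le> lam $ i"
  shows "pos_semidef (hessian (psi lam) y)"
  unfolding pos_semidef_def
proof (intro conjI allI)
  show "transpose (hessian (psi lam) y) = hessian (psi lam) y"
    by (auto simp: hessian_psi transpose_def vec_eq_iff)
  fix v :: "real ^ 'a"
  have "(hessian (psi lam) y *v v) $ i = lam $ i * v $ i" for i
    by (simp add: hessian_psi matrix_vector_mult_def if_distrib[of "\<lambda>x. x * _"] cong: if_cong)
  then have "v \<bullet> (hessian (psi lam) y *v v) = (\<Sum>i\<in>UNIV. lam $ i * (v $ i)\<^sup>2)"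
    by (simp add: inner_vec_def power2_eq_square algebra_simps)
  also have "\<dots> \<ge> 0"
    using assms by (intro sum_nonneg) simp
  finally show "0 \<le> v \<bullet> (hessian (psi lam) y *v v)" .
qed

text \<open>The index type carries no order, so \<open>ix\<close> numbers it from 1. A nonzero entry
  at position m is positive, hence so are all before it, and a support of fewer than k elements
  gives m < k.\<close>

lemma support_subset_sorted:
  fixes lam :: "real ^ 'n" and ix :: "nat \<Rightarrow> 'n"
  assumes "lam \<in> P1 k" "2 \<le> k" "bij_betw ix {1..CARD('n)} UNIV"
    and sorted: "\<forall>i j. 1 \<le> i \<and> i \<le> j \<and> j \<le> CARD('n) \<longrightarrow> lam $ ix j \<le> lam $ ix i"
  shows "{i. lam $ i \<noteq> 0} \<subseteq> ix ` {1..k - 1}"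
proof
  fix i assume "i \<in> {i. lam $ i \<noteq> 0}"
  moreover obtain m where m: "m \<in> {1..CARD('n)}" "i = ix m"
    using assms(3) by (metis UNIV_I bij_betw_imp_surj_on imageE)
  ultimately have "0 < lam $ ix m"
    using P1_nonneg_card_support(1)[OF assms(1), of i] by simp
  have "lam $ ix l \<noteq> 0" if "l \<in> {1..m}" for l
    using sorted[rule_format, of l m] that m \<open>0 < lam $ ix m\<close> by auto
  then have "card (ix ` {1..m}) \<le> card {i. lam $ i \<noteq> 0}"
    by (intro card_mono) auto
  moreover have "inj_on ix {1..m}"
    using assms(3) m by (auto simp: bij_betw_def intro: inj_on_subset)
  ultimately have "m < k"
    using P1_nonneg_card_support(2)[OF assms(1)] by (simp add: card_image)
  then show "i \<in> ix ` {1..k - 1}"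
    using m by auto
qed

theorem theorem2p5:
  fixes k :: nat and lam :: "real ^ 'n" and ix :: "nat \<Rightarrow> 'n"
  assumes "2 \<le> k" and "k \<le> CARD('n) - 1"
    and "lam \<in> bd_Gamma k"
    and labelling: "bij_betw ix {1..CARD('n)} UNIV"
  shows "(lam \<in> P2 k \<longrightarrow>
            solves_S_eq_0 k (psi lam) \<and> uniformly_elliptic (linearized_op k lam))
       \<and> (lam \<in> P1 k \<and> (\<forall>i j. 1 \<le> i \<and> i \<le> j \<and> j \<le> CARD('n) \<longrightarrow> lam $ ix j \<le> lam $ ix i) \<longrightarrow>
            solves_S_eq_0 k (psi lam)
          \<and> convex_on UNIV (psi lam) \<and> (\<forall>y. pos_semidef (hessian (psi lam) y))
          \<and> degenerate_elliptic (linearized_op k lam)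
          \<and> (\<forall>i\<in>{1..k - 1}. esym_del (k - 1) (ix i) lam = 0)
          \<and> (esym (k - 1) lam = 0 \<longrightarrow>
               linearized_op k lam = (\<lambda>v y. 0)
             \<and> (\<forall>i\<in>{1..CARD('n)}. esym_del (k - 1) (ix i) lam = 0))
          \<and> (esym (k - 1) lam > 0 \<longrightarrow>
               (\<forall>i\<in>{1..k - 1}. lam $ ix i > 0)
             \<and> (\<forall>i\<in>{k..CARD('n)}. lam $ ix i = 0)
             \<and> (\<forall>i\<in>{1..k - 1}. esym_del (k - 1) (ix i) lam = 0)
             \<and> (\<forall>i\<in>{k..CARD('n)}.
                  esym_del (k - 1) (ix i) lam = (\<Prod>j\<in>{1..k - 1}. lam $ ix j)
                \<and> (\<Prod>j\<in>{1..k - 1}. lam $ ix j) > 0)))"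
proof (intro conjI impI; (elim conjE)?)
  assume P2: "lam \<in> P2 k"
  show "solves_S_eq_0 k (psi lam)"
    using assms(3) by (intro solves_S_eq_0_psi) (simp add: bd_Gamma_def)
  show "uniformly_elliptic (linearized_op k lam)"
    unfolding uniformly_elliptic_def linearized_op_def
    using esym_del_pos[OF P2 assms(1)]
    by (intro exI[where x = "\<chi> i. esym_del (k - 1) i lam"] conjI refl allI) simp
next
  assume P1: "lam \<in> P1 k"
    and sorted: "\<forall>i j. 1 \<le> i \<and> i \<le> j \<and> j \<le> CARD('n) \<longrightarrow> lam $ ix j \<le> lam $ ix i"
  define N where "N = ix ` {1..k - 1}"
  note nonneg = P1_nonneg_card_support(1)[OF P1]
  have supp: "{i. lam $ i \<noteq> 0} \<subseteq> N"
    unfolding N_def using support_subset_sorted[OF P1 assms(1) labelling sorted] .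
  have inj: "inj_on ix {1..CARD('n)}"
    using labelling by (rule bij_betw_imp_inj_on)
  then have inj': "inj_on ix {1..k - 1}"
    by (rule inj_on_subset) (use assms(2) in auto)
  then have cardN: "card N = k - 1"
    by (simp add: N_def card_image)
  have del_nonneg: "0 \<le> esym_del j i lam" for j i
    unfolding esym_del_def using nonneg by (intro esym_nonneg) simp
  \<comment> \<open>Zeroing an entry of \<open>N\<close> leaves at most k - 2 nonzero entries, so
    every product of k - 1 entries vanishes.\<close>
  have del_0: "esym_del (k - 1) i lam = 0" if "i \<in> N" for i
    unfolding esym_del_def
  proof (rule esym_eq_0_if_card_support_less)
    have "card {m. (\<chi> m. if m = i then 0 else lam $ m) $ m \<noteq> 0} \<le> card (N - {i})"
      using supp by (intro card_mono) auto
    also have "\<dots> < card N"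
      using that by (intro card_Diff1_less) auto
    finally show "card {m. (\<chi> m. if m = i then 0 else lam $ m) $ m \<noteq> 0} < k - 1"
      by (simp add: cardN)
  qed
  show "solves_S_eq_0 k (psi lam)"
    using assms(3) by (intro solves_S_eq_0_psi) (simp add: bd_Gamma_def)
  show "convex_on UNIV (psi lam)"
    using nonneg by (rule convex_on_psi)
  show "\<forall>y. pos_semidef (hessian (psi lam) y)"
    using nonneg by (intro allI pos_semidef_hessian_psi)
  show del_ix: "\<forall>i\<in>{1..k - 1}. esym_del (k - 1) (ix i) lam = 0"
    using del_0 by (simp add: N_def)
  then show "\<forall>i\<in>{1..k - 1}. esym_del (k - 1) (ix i) lam = 0" .
  \<comment> \<open>Position 1 is at most k - 1 because k \<ge> 2; it supplies the vanishing
    coefficient.\<close>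
  have "esym_del (k - 1) (ix 1) lam = 0"
    using del_ix assms(1) by simp
  then show "degenerate_elliptic (linearized_op k lam)"
    unfolding degenerate_elliptic_def linearized_op_def
    using del_nonneg by (intro exI[where x = "\<chi> i. esym_del (k - 1) i lam"]) auto
  {
    assume 0: "esym (k - 1) lam = 0"
    have "esym_del (k - 1) i lam = 0" for i
    proof -
      \<comment> \<open>Both summands are nonnegative, so a zero sum makes each of them
        zero.\<close>
      have "esym (k - 1) lam = esym_del (k - 1) i lam + lam $ i * esym_del (k - 2) i lam"
        using esym_Suc_del[of "k - 2" lam i] assms(1) by (simp add: Suc_diff_Suc numeral_2_eq_2)
      then show ?thesis
        using 0 del_nonneg[of "k - 1" i] mult_nonneg_nonneg[OF nonneg[of i] del_nonneg[of "k - 2" i]]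
        by linarith
    qed
    then show "linearized_op k lam = (\<lambda>v y. 0)"
      and "\<forall>i\<in>{1..CARD('n)}. esym_del (k - 1) (ix i) lam = 0"
      by (simp_all add: linearized_op_def diag_op_def fun_eq_iff)
  next
    assume pos: "0 < esym (k - 1) lam"
    \<comment> \<open>\<open>N\<close> has k - 1 elements and contains the support, so a single
      product survives.\<close>
    have prod: "esym (k - 1) lam = (\<Prod>j\<in>{1..k - 1}. lam $ ix j)"
      using esym_card_support[OF supp] unfolding cardN unfolding N_def prod.reindex[OF inj'] by simp
    have zero: "lam $ ix i = 0" if "i \<in> {k..CARD('n)}" for i
    proof -
      have "ix i \<notin> N"
      proof
        assume "ix i \<in> N"
        then obtain j where "j \<in> {1..k - 1}" "ix i = ix j"
          by (auto simp: N_def)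
        then have "i = j"
          using inj_onD[OF inj] that assms(1,2) by auto
        then show False
          using that \<open>j \<in> {1..k - 1}\<close> by auto
      qed
      then show ?thesis
        using supp by auto
    qed
    show "\<forall>i\<in>{1..k - 1}. 0 < lam $ ix i"
    proof
      fix i assume "i \<in> {1..k - 1}"
      then have "lam $ ix i \<noteq> 0"
        using pos unfolding prod by (metis finite_atLeastAtMost less_irrefl prod_zero_iff)
      then show "0 < lam $ ix i"
        using nonneg[of "ix i"] by simp
    qed
    show "\<forall>i\<in>{k..CARD('n)}. lam $ ix i = 0"
      using zero by blast
    show "\<forall>i\<in>{k..CARD('n)}. esym_del (k - 1) (ix i) lam = (\<Prod>j\<in>{1..k - 1}. lam $ ix j)
        \<and> 0 < (\<Prod>j\<in>{1..k - 1}. lam $ ix j)"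
    proof
      fix i assume "i \<in> {k..CARD('n)}"
      \<comment> \<open>The entry to be replaced by 0 is already 0.\<close>
      then have "(\<chi> m. if m = ix i then 0 else lam $ m) = lam"
        using zero by (auto simp: vec_eq_iff)
      then have "esym_del (k - 1) (ix i) lam = esym (k - 1) lam"
        by (simp add: esym_del_def)
      then show "esym_del (k - 1) (ix i) lam = (\<Prod>j\<in>{1..k - 1}. lam $ ix j)
          \<and> 0 < (\<Prod>j\<in>{1..k - 1}. lam $ ix j)"
        using pos unfolding prod by (rule conjI)
    qed
  }
qed

end
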